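(* Let $m$ be a positive integer. Every positive integer solution $n$ of \[\sigma_2(n)-n^2=L_{2m}\,n-(F_{2m}^2-1)\] with $n>(L_{2m}+F_{2m}^2-1)^3$ is of one of the following forms: (i) $n=F_{2k+1}F_{2k+2m+1}$ for some integer $k\ge 0$, where both $F_{2k+1}$ and $F_{2k+2m+1}$ are primes; (ii) $n=F_{2k+1}F_{2m-2k-1}$ for some integer $k$ with $0\le k<m$ and $k\neq \frac{m-1}{2}$, where both $F_{2k+1}$ and $F_{2m-2k-1}$ are primes.
   Context: $\sigma_2(n)=\sum_{d\mid n}d^2$. $F_n$ are the Fibonacci numbers ($F_0=0$, $F_1=1$, $F_{n}=F_{n-1}+F_{n-2}$) and $L_n$ are the Lucas numbers ($L_0=2$, $L_1=1$, $L_n=L_{n-1}+L_{n-2}$). A Fibonacci prime is a Fibonacci number that is prime. *)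

theory Defs
  imports Complex_Main "HOL-Computational_Algebra.Primes" "HOL-Number_Theory.Fib"
begin

definition sigma2 :: "nat \<Rightarrow> nat" where
  "sigma2 n = (\<Sum>d | d dvd n. d ^ 2)"

fun lucas :: "nat \<Rightarrow> nat" where
  "lucas 0 = 2"
| "lucas (Suc 0) = 1"
| "lucas (Suc (Suc n)) = lucas (Suc n) + lucas n"

end

theory Submission
  imports Defs
begin

text \<open>
  Write \<open>A = L\<^bsub>2m\<^esub>\<close> and \<open>F = F\<^bsub>2m\<^esub>\<close>. If \<open>n\<close> had at least three prime factors, its smallest
  prime factor \<open>p\<close> would satisfy \<open>p\<^sup>3 \<le> n\<close>, and the divisor \<open>n / p\<close> alone would contribute more than
  \<open>A n\<close> to \<open>\<sigma>\<^sub>2(n) - n\<^sup>2\<close>. For a prime or the square of a prime,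
  \<open>\<sigma>\<^sub>2(n) - n\<^sup>2 \<le> n + 1\<close> is too small. So
  \<open>n = p q\<close> with \<open>p \<noteq> q\<close>, and the equation becomes \<open>p\<^sup>2 + q\<^sup>2 + F\<^sup>2 = A p q\<close>.
  Since \<open>A\<^sup>2 = 5 F\<^sup>2 + 4\<close>, completing the square shows that \<open>F\<close> divides \<open>2 q - A p\<close>, and the
  quotient \<open>z\<close> satisfies the Pell equation \<open>z\<^sup>2 - 5 p\<^sup>2 = -4\<close>. Hence \<open>p\<close> is a Fibonacci number with
  odd index \<open>j\<close>, and \<open>2 q = A p \<plusminus> F L\<^sub>j\<close> gives \<open>q = F\<^bsub>j+2m\<^esub>\<close> or \<open>q = F\<^bsub>|j-2m|\<^esub>\<close>.
\<close>

section \<open>Fibonacci and Lucas identities at fixed parity\<close>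

lemma lucas_Suc_eq_fib: "lucas (Suc n) = 2 * fib n + fib (Suc n)"
  by (induction n rule: fib.induct) auto

text \<open>Cassini's identity with \<open>fib (2 * k + 2)\<close> expanded, so that only two
  consecutive values occur, as in the equation solved by descent below.\<close>

lemma fib_Cassini_even:
  "int (fib (2 * k + 1)) ^ 2 = int (fib (2 * k)) ^ 2 + int (fib (2 * k)) * int (fib (2 * k + 1)) + 1"
proof (induction k)
  case (Suc k)
  then show ?case by (simp add: power2_eq_square algebra_simps)
qed simp

lemma fib_Cassini_odd:
  "int (fib (2 * k + 2)) ^ 2 = int (fib (2 * k + 1)) ^ 2 + int (fib (2 * k + 1)) * int (fib (2 * k + 2)) - 1"
  using fib_Cassini_even[of k] by (simp add: power2_eq_square algebra_simps)

text \<open>d'Ocagne's identity: after the addition formula the \<open>u\<close> terms cancel,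
  leaving \<open>v\<close> times a Cassini form equal to 1. This and its mirror image below evaluate
  the smaller root of the quadratic form.\<close>

lemma fib_dOcagne_ge:
  "int (fib (2 * m + 1)) * int (fib (2 * (m + 1 + d) + 1)) - int (fib (2 * m + 2)) * int (fib (2 * (m + 1 + d)))
     = int (fib (2 * d + 1))"
proof -
  define a b u v where defs: "a = int (fib (2 * m + 2))" "b = int (fib (2 * m + 1))"
    "u = int (fib (2 * d))" "v = int (fib (2 * d + 1))"
  have idx: "2 * (m + 1 + d) + 1 = Suc ((2 * m + 2) + 2 * d)"
    "2 * (m + 1 + d) = Suc ((2 * m + 1) + 2 * d)" by simp_all
  have 1: "int (fib (2 * (m + 1 + d) + 1)) = v * (a + b) + u * a"
    unfolding idx(1) fib_add[of "2 * m + 2" "2 * d"] defs by (simp add: algebra_simps)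
  have 2: "int (fib (2 * (m + 1 + d))) = v * a + u * b"
    unfolding idx(2) fib_add[of "2 * m + 1" "2 * d"] defs by (simp add: algebra_simps)
  have C: "a ^ 2 = b ^ 2 + b * a - 1"
    using fib_Cassini_odd[of m] by (simp add: defs)
  have "b * (v * (a + b) + u * a) - a * (v * a + u * b) = v * (b ^ 2 + b * a - a ^ 2)"
    by (simp add: power2_eq_square algebra_simps)
  also have "\<dots> = v" using C by simp
  finally show ?thesis unfolding 1 2 by (simp add: defs)
qed

lemma fib_dOcagne_lt:
  "int (fib (2 * (i + d) + 1)) * int (fib (2 * i + 1)) - int (fib (2 * (i + d) + 2)) * int (fib (2 * i))
     = int (fib (2 * d + 1))"
proof -
  define a b u v where defs: "a = int (fib (2 * i))" "b = int (fib (2 * i + 1))"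
    "u = int (fib (2 * d))" "v = int (fib (2 * d + 1))"
  have idx: "2 * (i + d) + 1 = Suc (2 * i + 2 * d)"
    "2 * (i + d) + 2 = Suc (2 * i + (2 * d + 1))" by simp_all
  have 1: "int (fib (2 * (i + d) + 1)) = v * b + u * a"
    unfolding idx(1) fib_add[of "2 * i" "2 * d"] defs by (simp add: algebra_simps)
  have 2: "int (fib (2 * (i + d) + 2)) = (u + v) * b + v * a"
    unfolding idx(2) fib_add[of "2 * i" "2 * d + 1"] defs by (simp add: algebra_simps)
  have C: "b ^ 2 = a ^ 2 + a * b + 1"
    using fib_Cassini_even[of i] by (simp add: defs)
  have "(v * b + u * a) * b - ((u + v) * b + v * a) * a = v * (b ^ 2 - a * b - a ^ 2)"
    by (simp add: power2_eq_square algebra_simps)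
  also have "\<dots> = v" using C by simp
  finally show ?thesis unfolding 1 2 by (simp add: defs)
qed

section \<open>The Pell equation with right-hand side -4\<close>

text \<open>Infinite descent: \<open>y' = y - c\<close> and \<open>c' = c - y'\<close> undo two
  Fibonacci steps and preserve the equation, down to the pair (0, 1).\<close>

lemma fib_consecutive_if_Cassini:
  fixes c y :: nat
  assumes "y ^ 2 = c ^ 2 + y * c + 1"
  shows "\<exists>i. c = fib (2 * i) \<and> y = fib (2 * i + 1)"
  using assms
proof (induction c arbitrary: y rule: less_induct)
  case (less c)
  show ?case
  proof (cases "c = 0")
    case True
    then have "y = 1" using less.prems by (simp add: power2_eq_square)
    then show ?thesis using True by (intro exI[of _ 0]) simp
  next
    case False
    have "c < y"
    proof (rule ccontr)
      assume "\<not> c < y"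
      then have "y ^ 2 \<le> c ^ 2" by (simp add: power_mono)
      then show False using less.prems by simp
    qed
    then obtain y' where y': "y = c + y'" using less_imp_add_positive by blast
    have eq: "y' ^ 2 + c * y' = c ^ 2 + 1"
      using less.prems unfolding y' by (simp add: power2_eq_square algebra_simps)
    have "y' \<le> c"
    proof (rule ccontr)
      assume "\<not> y' \<le> c"
      then have "c + 1 \<le> y'" by simp
      then have "(c + 1) ^ 2 \<le> y' ^ 2" by (rule power_mono) simp
      then show False using eq False by (simp add: power2_eq_square)
    qed
    then obtain c' where c': "c = c' + y'" using le_Suc_ex by (metis add.commute)
    have "y' ^ 2 = c' ^ 2 + y' * c' + 1"
      using eq unfolding c' by (simp add: power2_eq_square algebra_simps)
    moreover have "c' < c" using c' y' \<open>c < y\<close> by simp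
    ultimately obtain i where "c' = fib (2 * i)" "y' = fib (2 * i + 1)"
      using less.IH by blast
    then have "c = fib (2 * Suc i) \<and> y = fib (2 * Suc i + 1)"
      using c' y' by simp
    then show ?thesis by blast
  qed
qed

text \<open>Equal parity allows \<open>z = y + 2 * c\<close>, which turns the equation into Cassini
  form. The value found for \<open>z\<close> is the Lucas number of index
  \<open>2 * i + 1\<close>.\<close>

lemma Pell_minus_four_fib:
  fixes y z :: nat
  assumes "z ^ 2 + 4 = 5 * y ^ 2"
  shows "\<exists>i. y = fib (2 * i + 1) \<and> z = fib (2 * i + 1) + 2 * fib (2 * i)"
proof -
  have "y > 0" using assms by (cases y) auto
  have "y \<le> z"
  proof (rule ccontr)
    assume "\<not> y \<le> z"
    then have "z ^ 2 < y ^ 2" by (simp add: power_strict_mono)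
    moreover have "y ^ 2 \<ge> 1" using \<open>y > 0\<close> by simp
    ultimately show False using assms by linarith
  qed
  have "even (z ^ 2 + 4) = even (5 * y ^ 2)" using assms by simp
  then have "even z = even y" by simp
  then have "even (z - y)" using \<open>y \<le> z\<close> by simp
  then obtain c where "z - y = 2 * c" by blast
  then have z: "z = y + 2 * c" using \<open>y \<le> z\<close> by simp
  have "y ^ 2 = c ^ 2 + y * c + 1"
    using assms unfolding z by (simp add: power2_eq_square algebra_simps)
  then obtain i where "c = fib (2 * i)" "y = fib (2 * i + 1)"
    using fib_consecutive_if_Cassini by blast
  then show ?thesis using z by (intro exI[of _ i]) simp
qed

section \<open>The quadratic form in Fibonacci and Lucas numbers\<close>

text \<open>For fixed \<open>y\<close> the equation is quadratic in \<open>x\<close>. The first case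
  is the larger root; the other two are the smaller one, split so that the index subtraction does
  not truncate.\<close>

lemma fib_lucas_quadratic_form:
  fixes m x y :: nat
  assumes "m > 0"
    and eq: "int x ^ 2 + int y ^ 2 + int (fib (2 * m)) ^ 2 = int (lucas (2 * m)) * int x * int y"
  shows "\<exists>i. y = fib (2 * i + 1) \<and>
    (x = fib (2 * i + 2 * m + 1) \<or>
     (i < m \<and> x = fib (2 * m - 2 * i - 1)) \<or>
     (m \<le> i \<and> x = fib (2 * i + 1 - 2 * m)))"
proof -
  obtain r where m: "m = Suc r" using \<open>m > 0\<close> gr0_conv_Suc by blast
  define a b where ab: "a = int (fib (2 * r + 2))" "b = int (fib (2 * r + 1))"
  define t where "t = 2 * int x - (2 * b + a) * int y"
  have F: "int (fib (2 * m)) = a" by (simp add: ab m)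
  have L: "int (lucas (2 * m)) = 2 * b + a"
    using lucas_Suc_eq_fib[of "2 * r + 1"] by (simp add: ab m)
  have "a > 0" using fib_neq_0_nat[of "2 * r + 2"] unfolding ab by linarith
  have C: "a ^ 2 = b ^ 2 + b * a - 1"
    using fib_Cassini_odd[of r] by (simp add: ab)
  have disc: "(2 * b + a) ^ 2 = 5 * a ^ 2 + 4"
    using C by (simp add: power2_eq_square algebra_simps)
  have "t ^ 2 = 4 * (int x ^ 2 - (2 * b + a) * int x * int y) + (2 * b + a) ^ 2 * int y ^ 2"
    unfolding t_def by (simp add: power2_eq_square algebra_simps)
  also have "int x ^ 2 - (2 * b + a) * int x * int y = - (int y ^ 2) - a ^ 2"
    using eq unfolding F L by simp
  finally have t2: "t ^ 2 = a ^ 2 * (5 * int y ^ 2 - 4)"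
    unfolding disc by (simp add: algebra_simps)
  then have "a ^ 2 dvd t ^ 2" by simp
  then have "a dvd t" by simp
  then obtain z where z: "t = a * z" by blast
  have "a ^ 2 * z ^ 2 = a ^ 2 * (5 * int y ^ 2 - 4)"
    using t2 unfolding z by (simp add: power_mult_distrib)
  then have "z ^ 2 = 5 * int y ^ 2 - 4" using \<open>a > 0\<close> by simp
  then have "int (nat \<bar>z\<bar> ^ 2 + 4) = int (5 * y ^ 2)" by simp
  then have "nat \<bar>z\<bar> ^ 2 + 4 = 5 * y ^ 2" by (simp only: of_nat_eq_iff)
  then obtain i where y: "y = fib (2 * i + 1)" and zi: "nat \<bar>z\<bar> = fib (2 * i + 1) + 2 * fib (2 * i)"
    using Pell_minus_four_fib by blast
  define c where "c = int (fib (2 * i))"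
  have absz: "\<bar>z\<bar> = int y + 2 * c" using zi y by (simp add: c_def)
  have x: "2 * int x = (2 * b + a) * int y + a * z" using z t_def by simp
  show ?thesis
  \<comment> \<open>The sign of \<open>z\<close> selects the root.\<close>
  proof (cases "z \<ge> 0")
    case True
    then have "2 * int x = 2 * ((a + b) * int y + a * c)"
      using x absz by (simp add: algebra_simps)
    then have "int x = (a + b) * int y + a * c" by simp
    also have "\<dots> = int (fib (Suc ((2 * r + 2) + 2 * i)))"
      unfolding fib_add[of "2 * r + 2" "2 * i"] ab c_def y by (simp add: algebra_simps)
    also have "Suc ((2 * r + 2) + 2 * i) = 2 * i + 2 * m + 1" by (simp add: m)
    finally have "x = fib (2 * i + 2 * m + 1)" by (simp only: of_nat_eq_iff)
    then show ?thesis using y by blast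
  next
    case False
    then have zneg: "z = - (int y + 2 * c)" using absz by simp
    have "2 * int x = 2 * (b * int y - a * c)"
      using x unfolding zneg by (simp add: algebra_simps)
    then have xi: "int x = b * int y - a * c" by simp
    show ?thesis
    proof (cases "i < m")
      case True
      \<comment> \<open>Since \<open>m = Suc r\<close>, the condition \<open>i < m\<close> is
        \<open>i \<le> r\<close>.\<close>
      then obtain d where d: "r = i + d" using m less_Suc_eq_le le_Suc_ex by blast
      have "int x = int (fib (2 * d + 1))"
        using xi fib_dOcagne_lt[of i d] unfolding ab c_def y d by simp
      moreover have "2 * d + 1 = 2 * m - 2 * i - 1" using d m by simp
      ultimately have "x = fib (2 * m - 2 * i - 1)" by (simp only: of_nat_eq_iff)
      then show ?thesis using y True by blast
    next
      case False
      then obtain d where d: "i = r + 1 + d" using m le_Suc_ex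
        by (metis Suc_eq_plus1 not_less)
      have "int x = int (fib (2 * d + 1))"
        using xi fib_dOcagne_ge[of r d] unfolding ab c_def y d by simp
      moreover have "2 * d + 1 = 2 * i + 1 - 2 * m" using d m by simp
      ultimately have "x = fib (2 * i + 1 - 2 * m)" by (simp only: of_nat_eq_iff)
      then show ?thesis using y False by auto
    qed
  qed
qed

section \<open>Factorization types and bounds on the divisor sum\<close>

text \<open>Take \<open>p\<close> to be the least prime factor. If the cofactor is neither 1 nor
  prime, it splits into two factors that are each at least \<open>p\<close>.\<close>

lemma prime_semiprime_or_small_divisor:
  fixes n :: nat
  assumes "n > 1"
  obtains "prime n"
    | p q where "prime p" "prime q" "n = p * q"
    | p where "p > 1" "p dvd n" "p ^ 3 \<le> n"
proof -
  define p where "p = (LEAST p. prime p \<and> p dvd n)"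
  have "\<exists>p. prime p \<and> p dvd n" using assms by (intro prime_factor_nat) simp
  then have p: "prime p" "p dvd n" unfolding p_def by (metis (mono_tags, lifting) LeastI)+
  have least: "p \<le> q" if "prime q" "q dvd n" for q
    unfolding p_def using that by (simp add: Least_le)
  obtain r where r: "n = p * r" using p(2) by blast
  show thesis
  proof (cases "r = 1 \<or> prime r")
    case True
    then show thesis using that(1,2) p r by auto
  next
    case False
    then obtain q where q: "prime q" "q dvd r" using prime_factor_nat by blast
    then obtain s where s: "r = q * s" by blast
    have "s \<noteq> 1" using False q s by auto
    then obtain u where u: "prime u" "u dvd s" using prime_factor_nat by blast
    have "s > 0" using assms r s by (cases s) auto
    then have "u \<le> s" using u(2) by (simp add: dvd_imp_le)
    \<comment> \<open>\<open>s\<close> may be composite, so minimality of \<open>p\<close> is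
      applied to its prime factor \<open>u\<close>.\<close>
    moreover have "p \<le> u" using least u r s by simp
    ultimately have "p \<le> s" by simp
    moreover have "p \<le> q" using least q r by simp
    ultimately have "p * (p * p) \<le> p * (q * s)" by (intro mult_mono) auto
    then have "p ^ 3 \<le> n" using r s by (simp add: power3_eq_cube)
    then show thesis using that(3) p prime_gt_1_nat by blast
  qed
qed

lemma sigma2_prime: "prime p \<Longrightarrow> sigma2 p = p ^ 2 + 1"
proof -
  assume p: "prime p"
  then have "{d. d dvd p} = {1, p}" by (auto simp: prime_nat_iff)
  moreover have "p \<noteq> 1" using p by auto
  ultimately show ?thesis by (simp add: sigma2_def)
qed

lemma divisors_prime_mult:
  fixes p q :: nat
  assumes "prime p" "prime q"
  shows "{d. d dvd p * q} = {1, p, q, p * q}"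
proof -
  have "d \<in> {1, p, q, p * q}" if d: "d dvd p * q" for d
  proof -
    obtain a b where "d = a * b" "a dvd p" "b dvd q" using d division_decomp by blast
    moreover from this have "a = 1 \<or> a = p" "b = 1 \<or> b = q" using assms by (simp_all add: prime_nat_iff)
    ultimately show ?thesis by auto
  qed
  then show ?thesis by auto
qed

lemma sigma2_prime_mult:
  assumes "prime p" "prime q" "p \<noteq> q"
  shows "sigma2 (p * q) = 1 + p ^ 2 + q ^ 2 + (p * q) ^ 2"
proof -
  have "p > 1" "q > 1" using assms prime_gt_1_nat by auto
  then show ?thesis
    using assms(3) unfolding sigma2_def divisors_prime_mult[OF assms(1,2)] by simp
qed

lemma sigma2_prime_square:
  assumes "prime p"
  shows "sigma2 (p * p) = 1 + p ^ 2 + (p * p) ^ 2"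
proof -
  have "p > 1" using assms prime_gt_1_nat by auto
  then show ?thesis
    unfolding sigma2_def divisors_prime_mult[OF assms assms] by simp
qed

lemma sigma2_ge_cofactor:
  assumes "p > 1" "n = p * d" "n > 0"
  shows "n ^ 2 + d ^ 2 \<le> sigma2 n"
proof -
  have "d \<noteq> n" using assms by auto
  moreover have "sum (\<lambda>d. d ^ 2) {n, d} \<le> sigma2 n"
    unfolding sigma2_def using assms by (intro sum_mono2) auto
  ultimately show ?thesis by simp
qed

text \<open>With \<open>d = n / p\<close>, the size of \<open>p\<close> gives
  \<open>n ^ 2 \<le> d ^ 3\<close>, while the divisor sum gives \<open>d ^ 2 \<le> A * n\<close>.
  Eliminating \<open>d\<close> yields \<open>n ^ 4 \<le> A ^ 3 * n ^ 3\<close>.\<close>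

lemma le_cube_if_small_divisor:
  fixes A n p :: nat
  assumes "p > 1" "p dvd n" "p ^ 3 \<le> n" "n > 0" "sigma2 n \<le> n ^ 2 + A * n"
  shows "n \<le> A ^ 3"
proof -
  obtain d where d: "n = p * d" using assms(2) by blast
  have "n * n ^ 2 = p ^ 3 * d ^ 3" by (simp add: d power_mult_distrib power2_eq_square power3_eq_cube)
  also have "\<dots> \<le> n * d ^ 3" using assms(3) by simp
  finally have "n ^ 2 \<le> d ^ 3" using assms(4) by simp
  then have "(n ^ 2) ^ 2 \<le> (d ^ 3) ^ 2" by (rule power_mono) simp
  also have "\<dots> = (d ^ 2) ^ 3" by (simp flip: power_mult)
  also have "d ^ 2 \<le> A * n" using sigma2_ge_cofactor[OF assms(1) d assms(4)] assms(5) by simp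
  then have "(d ^ 2) ^ 3 \<le> (A * n) ^ 3" by (rule power_mono) simp
  also have "\<dots> = A ^ 3 * n ^ 3" by (simp add: power_mult_distrib)
  finally have "n * n ^ 3 \<le> A ^ 3 * n ^ 3" by (simp add: power2_eq_square power3_eq_cube mult.assoc)
  then show ?thesis using assms(4) by simp
qed

section \<open>From the divisor equation to the quadratic form\<close>

theorem theorem1p3:
  fixes m n :: nat
  assumes "m > 0" and "n > 0"
    and "int (sigma2 n) - int n ^ 2 = int (lucas (2 * m)) * int n - (int (fib (2 * m)) ^ 2 - 1)"
    and "int n > (int (lucas (2 * m)) + int (fib (2 * m)) ^ 2 - 1) ^ 3"
  shows "(\<exists>k. n = fib (2 * k + 1) * fib (2 * k + 2 * m + 1) \<and>
              prime (fib (2 * k + 1)) \<and> prime (fib (2 * k + 2 * m + 1))) \<or>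
         (\<exists>k. k < m \<and> real k \<noteq> (real m - 1) / 2 \<and>
              n = fib (2 * k + 1) * fib (2 * m - 2 * k - 1) \<and>
              prime (fib (2 * k + 1)) \<and> prime (fib (2 * m - 2 * k - 1)))"
proof -
  define A F where "A = lucas (2 * m)" and "F = fib (2 * m)"
  have eq: "int (sigma2 n) - int n ^ 2 = int A * int n - (int F ^ 2 - 1)"
    and big: "int n > (int A + int F ^ 2 - 1) ^ 3"
    using assms by (simp_all add: A_def F_def)
  have "F > 0" using \<open>m > 0\<close> by (simp add: F_def fib_neq_0_nat)
  then have F2: "F ^ 2 \<ge> 1" by simp
  obtain r where r: "2 * m = Suc (Suc (2 * r))"
    using \<open>m > 0\<close> by (metis gr0_conv_Suc mult_Suc_right add_2_eq_Suc)
  have "fib (Suc (2 * r)) > 0" by (rule fib_neq_0_nat) simp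
  then have A3: "A \<ge> 3"
    using lucas_Suc_eq_fib[of "Suc (2 * r)"] \<open>F > 0\<close> unfolding A_def F_def r by linarith
  \<comment> \<open>The base of the cube in the hypothesis, as a natural number. It dominates both
    \<open>A\<close> and \<open>F ^ 2\<close>, so \<open>n\<close> exceeds \<open>A ^ 3\<close> and
    \<open>F ^ 2\<close>.\<close>
  define S where "S = A + F ^ 2 - 1"
  have S: "int S = int A + int F ^ 2 - 1" using A3 F2 by (simp add: S_def of_nat_diff)
  have "int (S ^ 3) < int n" using big S by simp
  then have nS: "S ^ 3 < n" by (simp only: of_nat_less_iff)
  have AS: "A \<le> S" and FS: "F ^ 2 \<le> S" using A3 F2 by (simp_all add: S_def)
  have "S \<le> S ^ 3" using AS A3 by (intro self_le_power) auto
  then have "S < n" using nS by simp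
  then have Fn: "F ^ 2 < n" and "n > 1" using AS FS A3 by simp_all
  have "int (sigma2 n + F ^ 2) = int (n ^ 2 + A * n + 1)" using eq by simp
  then have eqn: "sigma2 n + F ^ 2 = n ^ 2 + A * n + 1" by (simp only: of_nat_eq_iff)
  have An: "3 * n \<le> A * n" using A3 by simp
  from \<open>n > 1\<close> show ?thesis
  proof (cases rule: prime_semiprime_or_small_divisor)
    case 1
    \<comment> \<open>For prime \<open>n\<close> the equation reads \<open>F ^ 2 = A * n\<close>,
      against \<open>F ^ 2 < n\<close>.\<close>
    then show ?thesis using eqn An Fn \<open>n > 1\<close> sigma2_prime[of n] by linarith
  next
    case (3 p)
    have "n \<le> A ^ 3"
      using 3 \<open>n > 0\<close> eqn F2 by (intro le_cube_if_small_divisor[of p]) auto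
    also have "\<dots> \<le> S ^ 3" using AS by (rule power_mono) simp
    finally show ?thesis using nS by simp
  next
    case (2 p q)
    have "p \<noteq> q"
    proof
      assume "p = q"
      then have "sigma2 n = 1 + n + n ^ 2" using sigma2_prime_square[OF 2(1)] 2(3)
        by (simp add: power2_eq_square)
      \<comment> \<open>Here \<open>n + F ^ 2 = A * n\<close>, but the left side is below
        \<open>2 * n\<close> and the right side is at least \<open>3 * n\<close>.\<close>
      then show False using eqn An Fn by linarith
    qed
    have "q ^ 2 + p ^ 2 + F ^ 2 = A * q * p"
      using eqn sigma2_prime_mult[OF 2(1,2) \<open>p \<noteq> q\<close>] unfolding 2(3) by (simp add: algebra_simps)
    then have "int (q ^ 2 + p ^ 2 + F ^ 2) = int (A * q * p)" by (simp only:)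
    then have "int q ^ 2 + int p ^ 2 + int (fib (2 * m)) ^ 2 = int (lucas (2 * m)) * int q * int p"
      by (simp add: A_def F_def)
    from fib_lucas_quadratic_form[OF \<open>m > 0\<close> this] obtain i where p: "p = fib (2 * i + 1)"
      and q: "q = fib (2 * i + 2 * m + 1) \<or>
         (i < m \<and> q = fib (2 * m - 2 * i - 1)) \<or> (m \<le> i \<and> q = fib (2 * i + 1 - 2 * m))"
      by blast
    from q consider "q = fib (2 * i + 2 * m + 1)"
      | "i < m" "q = fib (2 * m - 2 * i - 1)"
      | "m \<le> i" "q = fib (2 * i + 1 - 2 * m)" by blast
    then show ?thesis
    proof cases
      case 1
      then show ?thesis using p 2 by auto
    next
      case lt: 2
      \<comment> \<open>Equality would make the two Fibonacci indices coincide, forcing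
        \<open>p = q\<close>.\<close>
      have "real i \<noteq> (real m - 1) / 2"
      proof
        assume "real i = (real m - 1) / 2"
        then have "real m = real (2 * i + 1)" by simp
        then have "m = 2 * i + 1" by (simp only: of_nat_eq_iff)
        then have "2 * m - 2 * i - 1 = 2 * i + 1" by simp
        then show False using lt p \<open>p \<noteq> q\<close> by simp
      qed
      then show ?thesis using lt p 2 by blast
    next
      case ge: 3
      \<comment> \<open>Form (i) again, with \<open>p\<close> now carrying the larger index.\<close>
      define k where "k = i - m"
      have "2 * i + 1 - 2 * m = 2 * k + 1" "2 * i + 1 = 2 * k + 2 * m + 1"
        using ge(1) by (simp_all add: k_def)
      then have "q = fib (2 * k + 1)" "p = fib (2 * k + 2 * m + 1)" using ge(2) p by simp_all
      then show ?thesis using 2 by (metis mult.commute)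
    qed
  qed
qed

end
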